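(* Let $T$ be a non-trivial tree (a tree of order at least two) that is not isomorphic to $P_4$. Then $\mathrm{Sd}_f(T,\overline{T})=\dim_f(\overline{T})\ge\dim_f(T)$.
   Context: Graphs are finite, simple and undirected, and need not be connected. $\overline{G}$ is the complement of $G$ (on the same vertex set), and $P_n$ is the path on $n$ vertices. $d_G(x,y)$ is the least number of edges on a path joining $x$ and $y$ in $G$ ($\infty$ if there is none). For distinct $x,y\in V(G)$, $R_G\{x,y\}=\{z\in V(G): d_G(x,z)\ne d_G(y,z)\}$. For a function $g$ on $V$ and $U\subseteq V$, $g(U)=\sum_{s\in U}g(s)$. A resolving function of $G$ is a function $g:V(G)\to[0,1]$ with $g(R_G\{x,y\})\ge 1$ for all distinct $x,y\in V(G)$; the fractional dimension $\dim_f(G)$ is the minimum of $g(V(G))$ over all resolving functions $g$ of $G$. $\mathrm{Sd}_f(G,\overline{G})$ is the minimum of $g(V(G))$ over all functions $g:V(G)\to[0,1]$ that are resolving functions of both $G$ and $\overline{G}$. *)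

theory Defs
  imports "HOL-Analysis.Analysis" "HOL-Library.Extended_Nat"
begin

text \<open>A graph is a pair of a vertex set and a set of edges, an edge being a two-element set of
  vertices.\<close>

type_synonym 'a ugraph = "'a set \<times> 'a set set"

abbreviation verts :: "'a ugraph \<Rightarrow> 'a set" where
  "verts \<equiv> fst"

abbreviation edges :: "'a ugraph \<Rightarrow> 'a set set" where
  "edges \<equiv> snd"

definition simple_graph :: "'a ugraph \<Rightarrow> bool" where
  "simple_graph G \<longleftrightarrow> finite (verts G) \<and> (\<forall>e\<in>edges G. e \<subseteq> verts G \<and> card e = 2)"

definition complement :: "'a ugraph \<Rightarrow> 'a ugraph" where
  "complement G = (verts G, {e. e \<subseteq> verts G \<and> card e = 2 \<and> e \<notin> edges G})"

definition graph_iso :: "'a ugraph \<Rightarrow> 'b ugraph \<Rightarrow> bool" where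
  "graph_iso G H \<longleftrightarrow> (\<exists>f. bij_betw f (verts G) (verts H) \<and>
     (\<forall>u\<in>verts G. \<forall>v\<in>verts G. {u, v} \<in> edges G \<longleftrightarrow> {f u, f v} \<in> edges H))"

definition path_graph :: "nat \<Rightarrow> nat ugraph" where
  "path_graph n = ({..<n}, {{i, Suc i} | i. Suc i < n})"

text \<open>Paths are represented by their nonempty vertex lists.\<close>

definition gpath :: "'a ugraph \<Rightarrow> 'a list \<Rightarrow> bool" where
  "gpath G xs \<longleftrightarrow> xs \<noteq> [] \<and> distinct xs \<and> set xs \<subseteq> verts G \<and>
     successively (\<lambda>u v. {u, v} \<in> edges G) xs"

definition gpath_between :: "'a ugraph \<Rightarrow> 'a \<Rightarrow> 'a \<Rightarrow> 'a list \<Rightarrow> bool" where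
  "gpath_between G x y xs \<longleftrightarrow> gpath G xs \<and> hd xs = x \<and> last xs = y"

definition gconnected :: "'a ugraph \<Rightarrow> bool" where
  "gconnected G \<longleftrightarrow> verts G \<noteq> {} \<and> (\<forall>x\<in>verts G. \<forall>y\<in>verts G. \<exists>xs. gpath_between G x y xs)"

definition gcycle :: "'a ugraph \<Rightarrow> 'a list \<Rightarrow> bool" where
  "gcycle G xs \<longleftrightarrow> gpath G xs \<and> length xs \<ge> 3 \<and> {last xs, hd xs} \<in> edges G"

definition tree :: "'a ugraph \<Rightarrow> bool" where
  "tree G \<longleftrightarrow> simple_graph G \<and> gconnected G \<and> (\<nexists>xs. gcycle G xs)"

text \<open>The infimum of the empty set in \<^typ>\<open>enat\<close> is \<open>\<infinity>\<close>, so vertices in different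
  components are at distance \<open>\<infinity>\<close>.\<close>

definition gdist :: "'a ugraph \<Rightarrow> 'a \<Rightarrow> 'a \<Rightarrow> enat" where
  "gdist G x y = (INF xs \<in> {xs. gpath_between G x y xs}. enat (length xs - 1))"

definition resolving_set :: "'a ugraph \<Rightarrow> 'a \<Rightarrow> 'a \<Rightarrow> 'a set" where
  "resolving_set G x y = {z \<in> verts G. gdist G x z \<noteq> gdist G y z}"

text \<open>Only the values of \<open>g\<close> on \<open>verts G\<close> matter.\<close>

definition resolving_function :: "'a ugraph \<Rightarrow> ('a \<Rightarrow> real) \<Rightarrow> bool" where
  "resolving_function G g \<longleftrightarrow> (\<forall>v\<in>verts G. g v \<in> {0..1}) \<and>
     (\<forall>x\<in>verts G. \<forall>y\<in>verts G. x \<noteq> y \<longrightarrow> sum g (resolving_set G x y) \<ge> 1)"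

text \<open>Minima of sets of reals are taken with \<^const>\<open>Least\<close>; that they are attained is proved
  below.\<close>

definition frac_dim :: "'a ugraph \<Rightarrow> real" where
  "frac_dim G = (LEAST r. \<exists>g. resolving_function G g \<and> r = sum g (verts G))"

text \<open>For two graphs with the same vertex set.\<close>

definition sim_frac_dim :: "'a ugraph \<Rightarrow> 'a ugraph \<Rightarrow> real" where
  "sim_frac_dim G H =
     (LEAST r. \<exists>g. resolving_function G g \<and> resolving_function H g \<and> r = sum g (verts G))"

lemma gdist_self:
  assumes "x \<in> verts G" shows "gdist G x x = 0"
proof -
  have "gpath_between G x x [x]"
    using assms by (simp add: gpath_between_def gpath_def)
  then have "gdist G x x \<le> enat (length [x] - 1)"
    unfolding gdist_def by (intro INF_lower) simp
  then show ?thesis by (simp add: zero_enat_def[symmetric])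
qed

lemma gdist_neq_zero:
  assumes "x \<noteq> y" shows "gdist G x y \<noteq> 0"
proof -
  have "1 \<le> gdist G x y"
    unfolding gdist_def
  proof (rule INF_greatest)
    fix xs assume "xs \<in> {xs. gpath_between G x y xs}"
    then have *: "xs \<noteq> []" "hd xs = x" "last xs = y"
      by (auto simp: gpath_between_def gpath_def)
    have "length xs \<ge> 2"
      using * assms by (cases xs; cases "tl xs") auto
    then show "1 \<le> enat (length xs - 1)" by (simp add: one_enat_def)
  qed
  then show ?thesis by auto
qed

lemma resolving_function_one:
  assumes "simple_graph G" shows "resolving_function G (\<lambda>_. 1)"
  unfolding resolving_function_def
proof (intro conjI ballI impI)
  fix x y assume xy: "x \<in> verts G" "y \<in> verts G" "x \<noteq> y"
  have fin: "finite (resolving_set G x y)"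
    using assms by (auto simp: resolving_set_def simple_graph_def)
  have "x \<in> resolving_set G x y"
    using xy gdist_self[of x G] gdist_neq_zero[of y x G] by (auto simp: resolving_set_def)
  with fin have "card (resolving_set G x y) \<noteq> 0" by auto
  then show "sum (\<lambda>_. 1 :: real) (resolving_set G x y) \<ge> 1" by simp
qed auto

lemma simple_graph_complement:
  "simple_graph G \<Longrightarrow> simple_graph (complement G)"
  by (auto simp: simple_graph_def complement_def)

lemma minimum_attained:
  fixes V :: "'a set" and \<A> :: "'a set set"
  assumes fin: "finite V" and sub: "\<And>A. A \<in> \<A> \<Longrightarrow> A \<subseteq> V"
    and ne: "\<And>A. A \<in> \<A> \<Longrightarrow> A \<noteq> {}"
  shows "\<exists>g. (\<forall>v\<in>V. g v \<in> {0..1::real}) \<and> (\<forall>A\<in>\<A>. sum g A \<ge> 1) \<and>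
    (\<forall>h. (\<forall>v\<in>V. h v \<in> {0..1}) \<and> (\<forall>A\<in>\<A>. sum h A \<ge> 1) \<longrightarrow> sum g V \<le> sum h V)"
proof -
  define S where "S = (\<lambda>v. if v \<in> V then {0..1::real} else {0})"
  define K where "K = PiE UNIV S \<inter> (\<Inter>A\<in>\<A>. {g. sum g A \<ge> 1})"
  have "compactin (product_topology (\<lambda>_. euclidean) UNIV) (PiE UNIV S)"
    by (subst compactin_PiE) (auto simp: S_def)
  then have "compact (PiE UNIV S)"
    by (simp add: euclidean_product_topology)
  moreover have cont: "continuous_on UNIV (\<lambda>g :: 'a \<Rightarrow> real. sum g A)" for A
    by (intro continuous_intros continuous_on_product_coordinates)
  have "closed {g :: 'a \<Rightarrow> real. sum g A \<ge> 1}" for A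
    by (intro closed_Collect_le cont continuous_on_const)
  ultimately have "compact K"
    unfolding K_def by (intro compact_Int_closed closed_INT) auto
  have in_K: "(\<lambda>v. if v \<in> V then h v else 0) \<in> K"
    if "\<forall>v\<in>V. h v \<in> {0..1}" "\<forall>A\<in>\<A>. sum h A \<ge> 1" for h
  proof -
    have "sum (\<lambda>v. if v \<in> V then h v else 0) A = sum h A" if "A \<in> \<A>" for A
      using sub[OF that] by (intro sum.cong) auto
    with that show ?thesis by (auto simp: K_def S_def)
  qed
  have "sum (\<lambda>_. 1 :: real) A \<ge> 1" if "A \<in> \<A>" for A
  proof -
    have "card A \<noteq> 0" using that ne sub fin finite_subset by fastforce
    then show ?thesis by simp
  qed
  then have "K \<noteq> {}" using in_K[of "\<lambda>_. 1"] by auto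
  then obtain g where g: "g \<in> K" "\<And>h. h \<in> K \<Longrightarrow> sum g V \<le> sum h V"
    using continuous_attains_inf[OF \<open>compact K\<close> _ continuous_on_subset[OF cont subset_UNIV]]
    by meson
  have "g v \<in> {0..1}" if "v \<in> V" for v
  proof -
    have "g v \<in> S v" using g(1) by (auto simp: K_def)
    then show ?thesis using that by (simp add: S_def)
  qed
  moreover have "\<forall>A\<in>\<A>. sum g A \<ge> 1" using g(1) by (auto simp: K_def)
  moreover have "sum g V \<le> sum h V" if "\<forall>v\<in>V. h v \<in> {0..1}" "\<forall>A\<in>\<A>. sum h A \<ge> 1" for h
    using g(2)[OF in_K[OF that]] by (simp cong: sum.cong)
  ultimately show ?thesis by blast
qed

lemma sim_frac_dim_attained:
  assumes "simple_graph G" "simple_graph H" "verts G = verts H"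
  shows "\<exists>g. resolving_function G g \<and> resolving_function H g \<and> sum g (verts G) = sim_frac_dim G H"
    and "resolving_function G h \<Longrightarrow> resolving_function H h \<Longrightarrow> sim_frac_dim G H \<le> sum h (verts G)"
proof -
  define \<A> where "\<A> = {resolving_set F x y | F x y.
    F \<in> {G, H} \<and> x \<in> verts G \<and> y \<in> verts G \<and> x \<noteq> y}"
  have iff: "resolving_function G g \<and> resolving_function H g \<longleftrightarrow>
      (\<forall>v\<in>verts G. g v \<in> {0..1}) \<and> (\<forall>A\<in>\<A>. sum g A \<ge> 1)" for g
    unfolding resolving_function_def \<A>_def assms(3) by blast
  have ne: "resolving_set F x y \<noteq> {}" if "simple_graph F" "x \<in> verts F" "y \<in> verts F" "x \<noteq> y"
    for F :: "'a ugraph" and x y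
    using resolving_function_one[OF that(1)] that(2-4)
    unfolding resolving_function_def by fastforce
  have ne': "A \<noteq> {}" if "A \<in> \<A>" for A
    using that ne assms unfolding \<A>_def by auto
  have sub: "A \<subseteq> verts G" if "A \<in> \<A>" for A
  proof -
    obtain F x y where "A = resolving_set F x y" "F \<in> {G, H}"
      using \<open>A \<in> \<A>\<close> unfolding \<A>_def by blast
    moreover have "verts F = verts G" using \<open>F \<in> {G, H}\<close> assms(3) by fastforce
    ultimately show ?thesis unfolding resolving_set_def by blast
  qed
  have fin: "finite (verts G)" using assms(1) by (simp add: simple_graph_def)
  obtain g where g0: "\<forall>v\<in>verts G. g v \<in> {0..1::real}" "\<forall>A\<in>\<A>. sum g A \<ge> 1"
    and min: "\<forall>h. (\<forall>v\<in>verts G. h v \<in> {0..1}) \<and> (\<forall>A\<in>\<A>. sum h A \<ge> 1) \<longrightarrow>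
      sum g (verts G) \<le> sum h (verts G)"
    using minimum_attained[OF fin sub ne'] by blast
  have g: "resolving_function G g \<and> resolving_function H g"
    unfolding iff using g0 by (rule conjI)
  have g_min: "sum g (verts G) \<le> sum h (verts G)"
    if "resolving_function G h" "resolving_function H h" for h
  proof -
    have "resolving_function G h \<and> resolving_function H h" using that by (rule conjI)
    then show ?thesis unfolding iff by (rule min[rule_format])
  qed
  have *: "sim_frac_dim G H = sum g (verts G)"
    unfolding sim_frac_dim_def by (rule Least_equality) (use g g_min in blast)+
  show "\<exists>g. resolving_function G g \<and> resolving_function H g \<and> sum g (verts G) = sim_frac_dim G H"
    using g by (intro exI[of _ g]) (simp add: *)
  show "resolving_function G h \<Longrightarrow> resolving_function H h \<Longrightarrow> sim_frac_dim G H \<le> sum h (verts G)"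
    unfolding * by (rule g_min)
qed

lemma frac_dim_attained:
  assumes "simple_graph G"
  shows "\<exists>g. resolving_function G g \<and> sum g (verts G) = frac_dim G"
    and "resolving_function G h \<Longrightarrow> frac_dim G \<le> sum h (verts G)"
proof -
  have "frac_dim G = sim_frac_dim G G" by (simp add: frac_dim_def sim_frac_dim_def)
  then show "\<exists>g. resolving_function G g \<and> sum g (verts G) = frac_dim G"
    and "resolving_function G h \<Longrightarrow> frac_dim G \<le> sum h (verts G)"
    using sim_frac_dim_attained[OF assms assms refl] by auto
qed

end

theory Submission
  imports Defs
begin

text \<open>
  Call \<open>L(x,y)\<close> the set that consists of \<open>x\<close>, \<open>y\<close> and the vertices adjacent to exactly one of
  them. Adjacency decides which distances are 1, so \<open>L(x,y)\<close> is contained in the resolving set of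
  \<open>x, y\<close> in every graph; and it is the same set for \<open>G\<close> and for its complement. When all distances
  in the complement are at most 2, the resolving sets of the complement are exactly the sets
  \<open>L(x,y)\<close>, so every resolving function of the complement also resolves \<open>G\<close>, and the simultaneous
  dimension is the dimension of the complement.

  A vertex \<open>z\<close> outside \<open>L(x,y)\<close> can resolve \<open>x, y\<close> in the complement only if \<open>z\<close> is a common
  neighbour of both in \<open>G\<close> and one of the edges \<open>xz\<close>, \<open>yz\<close> dominates \<open>G\<close>
  (\<open>complement_resolves_beyond_adj\<close>). In a tree a dominating edge \<open>ab\<close> makes every other vertex a leaf
  at \<open>a\<close> or at \<open>b\<close>. Two leaves at the same centre are twins, and a resolving function of the
  complement gives them total weight at least 1. If it nevertheless fails to resolve \<open>a\<close> and a leaf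
  \<open>l\<close> at \<open>b\<close> in \<open>G\<close>, then there is only one leaf \<open>m\<close> at \<open>a\<close>: all leaves at \<open>a\<close> belong to
  \<open>L(a,l)\<close>. Hence the tree is a broom, the path \<open>m, a, b\<close> with a set \<open>B\<close> of leaves at \<open>b\<close>
  (\<open>broom_if_not_resolving\<close>).

  If \<open>B\<close> is a single leaf, the broom is the excluded path on four vertices. Otherwise the leaves in
  \<open>B\<close> carry weight at least 1, and moving the weight of \<open>b\<close> to \<open>a\<close> yields a function of no greater
  total weight that resolves both graphs (\<open>broom_exchange\<close>). So some optimal resolving function of the
  complement resolves \<open>G\<close> as well, which gives the equality, and the inequality follows from it.

  The only cycles that have to be excluded are triangles and four-cycles, so the argument is carried
  out for graphs of girth at least five.
\<close>

section \<open>Distances zero, one and two\<close>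

definition adj :: "'a ugraph \<Rightarrow> 'a \<Rightarrow> 'a \<Rightarrow> bool" where
  "adj G u v \<longleftrightarrow> {u, v} \<in> edges G"

lemma adj_commute: "adj G u v \<longleftrightarrow> adj G v u"
  by (simp add: adj_def insert_commute)

lemma adj_irrefl: "simple_graph G \<Longrightarrow> \<not> adj G u u"
  by (fastforce simp: adj_def simple_graph_def)

lemma adj_in_verts: "simple_graph G \<Longrightarrow> adj G u v \<Longrightarrow> u \<in> verts G \<and> v \<in> verts G"
  by (fastforce simp: adj_def simple_graph_def)

lemma adj_complement:
  "adj (complement G) u v \<longleftrightarrow> u \<in> verts G \<and> v \<in> verts G \<and> u \<noteq> v \<and> \<not> adj G u v"
  by (auto simp: adj_def complement_def card_insert_if)

lemma verts_complement [simp]: "verts (complement G) = verts G"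
  by (simp add: complement_def)

lemma gdist_eq_1_iff:
  assumes "x \<in> verts G" "y \<in> verts G" "x \<noteq> y"
  shows "gdist G x y = 1 \<longleftrightarrow> adj G x y"
proof
  assume adj: "adj G x y"
  have "gpath_between G x y [x, y]"
    using assms adj by (simp add: gpath_between_def gpath_def adj_def)
  then have "gdist G x y \<le> enat (length [x, y] - 1)"
    unfolding gdist_def by (intro INF_lower) simp
  then have "gdist G x y \<le> 1"
    by (simp add: one_enat_def)
  moreover have "1 \<le> gdist G x y"
    using gdist_neq_zero[OF assms(3), of G] by (simp add: ileI1 one_eSuc)
  ultimately show "gdist G x y = 1"
    by (rule antisym)
next
  show "adj G x y" if "gdist G x y = 1"
  proof (rule ccontr)
    assume nadj: "\<not> adj G x y"
    have "2 \<le> gdist G x y"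
      unfolding gdist_def
    proof (rule INF_greatest)
      fix xs assume "xs \<in> {xs. gpath_between G x y xs}"
      then have *: "xs \<noteq> []" "hd xs = x" "last xs = y" "successively (adj G) xs"
        by (auto simp: gpath_between_def gpath_def adj_def[abs_def])
      have "length xs \<ge> 3"
        using * assms(3) nadj by (cases xs; cases "tl xs"; cases "tl (tl xs)") auto
      then show "2 \<le> enat (length xs - 1)"
        by (simp add: numeral_eq_enat)
    qed
    with that show False
      by (simp add: one_enat_def numeral_eq_enat)
  qed
qed

lemma gdist_common_neighbour:
  assumes "x \<in> verts G" "y \<in> verts G" "w \<in> verts G" "x \<noteq> y" "w \<noteq> x" "w \<noteq> y"
    and "adj G x w" "adj G w y" "\<not> adj G x y"
  shows "gdist G x y = 2"
proof -
  have "gpath_between G x y [x, w, y]"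
    using assms by (auto simp: gpath_between_def gpath_def adj_def)
  then have "gdist G x y \<le> enat (length [x, w, y] - 1)"
    unfolding gdist_def by (intro INF_lower) simp
  then have "gdist G x y \<le> 2"
    by (simp add: numeral_eq_enat numeral_2_eq_2)
  moreover have "gdist G x y \<noteq> 0" "gdist G x y \<noteq> 1"
    using gdist_neq_zero gdist_eq_1_iff assms by metis+
  ultimately show ?thesis
    by (cases "gdist G x y") (auto simp: numeral_eq_enat one_enat_def zero_enat_def)
qed

text \<open>Complements may be disconnected: a vertex adjacent to all others in \<open>G\<close> is isolated in the
  complement, at distance \<open>\<infinity>\<close> from everything else.\<close>

lemma gdist_isolated:
  assumes "x \<noteq> z" "\<And>w. \<not> adj G w z"
  shows "gdist G x z = \<infinity>"
proof -
  have False if "gpath_between G x z xs" for xs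
  proof -
    have *: "xs \<noteq> []" "hd xs = x" "last xs = z" "successively (adj G) xs"
      using that by (auto simp: gpath_between_def gpath_def adj_def[abs_def])
    obtain ys where ys: "xs = ys @ [z]"
      using *(1,3) by (metis append_butlast_last_id)
    then have "ys \<noteq> []"
      using *(2) assms(1) by auto
    then have "adj G (last ys) z"
      using *(4) unfolding ys by (simp add: successively_append_iff)
    with assms(2) show False
      by blast
  qed
  then have "{xs. gpath_between G x z xs} = {}"
    by blast
  then show ?thesis
    by (simp add: gdist_def top_enat_def)
qed

section \<open>What adjacency alone resolves\<close>

text \<open>The set written \<open>L(x,y)\<close> above; these are the sets that a resolving function must weigh in
  the adjacency version of fractional dimension, where distances are truncated at 2.\<close>

definition adj_resolving_set :: "'a ugraph \<Rightarrow> 'a \<Rightarrow> 'a \<Rightarrow> 'a set" where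
  "adj_resolving_set G x y = {z \<in> verts G. z = x \<or> z = y \<or> adj G x z \<noteq> adj G y z}"

lemma adj_resolving_set_commute: "adj_resolving_set G x y = adj_resolving_set G y x"
  by (auto simp: adj_resolving_set_def)

lemma adj_resolving_set_subset:
  assumes "x \<in> verts G" "y \<in> verts G" "x \<noteq> y"
  shows "adj_resolving_set G x y \<subseteq> resolving_set G x y"
proof
  fix z assume z: "z \<in> adj_resolving_set G x y"
  then have zV: "z \<in> verts G"
    by (simp add: adj_resolving_set_def)
  show "z \<in> resolving_set G x y"
  proof (cases "z = x \<or> z = y")
    case True
    then show ?thesis
      using zV assms gdist_self[of z G] gdist_neq_zero[of x y G] gdist_neq_zero[of y x G]
      by (auto simp: resolving_set_def)
  next
    case False
    then have "(gdist G x z = 1) \<noteq> (gdist G y z = 1)"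
      using z gdist_eq_1_iff[of x G z] gdist_eq_1_iff[of y G z] zV assms
      by (auto simp: adj_resolving_set_def)
    then show ?thesis
      using zV by (auto simp: resolving_set_def)
  qed
qed

lemma adj_resolving_set_complement:
  assumes "x \<in> verts G" "y \<in> verts G"
  shows "adj_resolving_set (complement G) x y = adj_resolving_set G x y"
  using assms by (auto simp: adj_resolving_set_def adj_complement)

text \<open>For an edge of \<open>G\<close>, domination means that its ends have no common neighbour in the
  complement, so that their distance there exceeds 2.\<close>

definition dominating_pair :: "'a ugraph \<Rightarrow> 'a \<Rightarrow> 'a \<Rightarrow> bool" where
  "dominating_pair G u v \<longleftrightarrow> (\<forall>w\<in>verts G. w = u \<or> w = v \<or> adj G u w \<or> adj G v w)"

lemma gdist_complement_not_dominating:
  assumes "u \<in> verts G" "v \<in> verts G" "u \<noteq> v" "adj G u v" "\<not> dominating_pair G u v"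
  shows "gdist (complement G) u v = 2"
proof -
  obtain w where w: "w \<in> verts G" "w \<noteq> u" "w \<noteq> v" "\<not> adj G u w" "\<not> adj G v w"
    using assms(5) by (auto simp: dominating_pair_def)
  then show ?thesis
    using assms by (intro gdist_common_neighbour[where w = w])
      (auto simp: adj_complement adj_commute[of G w])
qed

text \<open>Outside \<open>L(x,y)\<close>, \<open>z\<close> has the same adjacencies to \<open>x\<close> and \<open>y\<close>. If it is adjacent to
  neither in \<open>G\<close>, both distances in the complement are 1. If it is adjacent to both and neither edge
  dominates, both are 2; and if \<open>z\<close> is adjacent to every other vertex, both are \<open>\<infinity>\<close>. The last case
  is what later guarantees a leaf at the second end of the dominating edge, which excludes stars.\<close>

lemma complement_resolves_beyond_adj:
  assumes G: "simple_graph G" and xy: "x \<in> verts G" "y \<in> verts G"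
    and z: "z \<in> resolving_set (complement G) x y" "z \<notin> adj_resolving_set G x y"
  shows "adj G x z" "adj G y z" "dominating_pair G x z \<or> dominating_pair G y z"
    "\<exists>w\<in>verts G. w \<noteq> z \<and> \<not> adj G z w"
proof -
  have zV: "z \<in> verts G" and d: "gdist (complement G) x z \<noteq> gdist (complement G) y z"
    using z(1) by (auto simp: resolving_set_def)
  have zxy: "z \<noteq> x" "z \<noteq> y" and eq: "adj G x z = adj G y z"
    using z(2) zV by (auto simp: adj_resolving_set_def)
  show xz: "adj G x z"
  proof (rule ccontr)
    assume "\<not> adj G x z"
    then have "gdist (complement G) x z = 1 \<and> gdist (complement G) y z = 1"
      using eq xy zV zxy by (auto simp: gdist_eq_1_iff adj_complement)
    with d show False
      by simp
  qed
  with eq show yz: "adj G y z"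
    by simp
  show "dominating_pair G x z \<or> dominating_pair G y z"
    using gdist_complement_not_dominating[of x G z] gdist_complement_not_dominating[of y G z]
      xz yz xy zV zxy d by metis
  show "\<exists>w\<in>verts G. w \<noteq> z \<and> \<not> adj G z w"
  proof (rule ccontr)
    assume "\<not> (\<exists>w\<in>verts G. w \<noteq> z \<and> \<not> adj G z w)"
    then have "\<not> adj (complement G) w z" for w
      by (auto simp: adj_complement adj_commute[of G w])
    then have "gdist (complement G) x z = \<infinity>" "gdist (complement G) y z = \<infinity>"
      using zxy by (auto intro: gdist_isolated)
    with d show False
      by simp
  qed
qed

lemma resolving_functionD:
  assumes "resolving_function G g" "x \<in> verts G" "y \<in> verts G" "x \<noteq> y"
  shows "sum g (resolving_set G x y) \<ge> 1"
  using assms by (simp add: resolving_function_def)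

lemma sum_mono_set:
  fixes g :: "'a \<Rightarrow> real"
  assumes "finite V" "\<forall>v\<in>V. g v \<in> {0..1}" "A \<subseteq> B" "B \<subseteq> V"
  shows "sum g A \<le> sum g B"
  using assms by (intro sum_mono2) (auto intro: finite_subset)

text \<open>Two leaves \<open>u, v\<close> at the same vertex \<open>c\<close> have \<open>L(u,v) = {u, v}\<close>, and a vertex \<open>t\<close> away from
  \<open>c\<close> keeps the edges \<open>uc\<close> and \<open>vc\<close> from dominating, so nothing else resolves them in the
  complement.\<close>

lemma complement_twins_weight:
  assumes G: "simple_graph G" and g: "resolving_function (complement G) g"
    and c: "\<And>w. adj G u w \<longleftrightarrow> w = c" "\<And>w. adj G v w \<longleftrightarrow> w = c"
    and t: "t \<in> verts G" "t \<notin> {u, v, c}" "\<not> adj G c t"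
    and uv: "u \<noteq> v"
  shows "g u + g v \<ge> 1"
proof -
  have V: "u \<in> verts G" "v \<in> verts G"
    using adj_in_verts[OF G] c by blast+
  have "resolving_set (complement G) u v \<subseteq> {u, v}"
  proof
    fix z assume z: "z \<in> resolving_set (complement G) u v"
    show "z \<in> {u, v}"
    proof (rule ccontr)
      assume "z \<notin> {u, v}"
      then have nz: "z \<notin> adj_resolving_set G u v"
        using c by (auto simp: adj_resolving_set_def)
      from complement_resolves_beyond_adj[OF G V z nz] c have "z = c"
        "dominating_pair G u c \<or> dominating_pair G v c"
        by auto
      with t c show False
        by (auto simp: dominating_pair_def)
    qed
  qed
  then have "sum g (resolving_set (complement G) u v) \<le> sum g {u, v}"
    using g V by (intro sum_mono2) (auto simp: resolving_function_def)
  with resolving_functionD[OF g, of u v] V uv show ?thesis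
    by simp
qed

section \<open>Brooms\<close>

text \<open>The path \<open>m, a, b\<close> with the vertices of \<open>B\<close> attached as leaves at \<open>b\<close>.\<close>

definition is_broom :: "'a ugraph \<Rightarrow> 'a \<Rightarrow> 'a \<Rightarrow> 'a \<Rightarrow> 'a set \<Rightarrow> bool" where
  "is_broom G m a b B \<longleftrightarrow> verts G = {m, a, b} \<union> B \<and> distinct [m, a, b] \<and> B \<inter> {m, a, b} = {} \<and>
     (\<forall>u v. adj G u v \<longleftrightarrow>
        {u, v} = {m, a} \<or> {u, v} = {a, b} \<or> (\<exists>l\<in>B. {u, v} = {b, l}))"

text \<open>In the complement of a broom, \<open>b\<close> has distance 3 from \<open>a\<close> but 2 from each leaf \<open>l \<in> B\<close>, so it
  resolves \<open>a, l\<close> there, while both distances are 1 in \<open>G\<close>. Weight on \<open>b\<close> is therefore what may fail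
  to carry over to \<open>G\<close>, and it is moved to \<open>a\<close>. This is harmless for the complement because every
  resolving set that contains \<open>b\<close> but not \<open>a\<close> contains all of \<open>B\<close>, whose weight is at least 1 by the
  twins \<open>l1, l2\<close>.\<close>

lemma broom_exchange:
  assumes G: "simple_graph G" and broom: "is_broom G m a b B"
    and l: "l1 \<in> B" "l2 \<in> B" "l1 \<noteq> l2"
    and g: "resolving_function (complement G) g"
  obtains h where "resolving_function G h" "resolving_function (complement G) h"
    "sum h (verts G) \<le> sum g (verts G)"
proof -
  let ?R = "resolving_set (complement G)" and ?L = "adj_resolving_set G"
  have V: "verts G = {m, a, b} \<union> B"
    and dist: "m \<noteq> a" "m \<noteq> b" "a \<noteq> b" "m \<notin> B" "a \<notin> B" "b \<notin> B"
    and E: "\<And>u v. adj G u v \<longleftrightarrow> {u, v} = {m, a} \<or> {u, v} = {a, b} \<or> (\<exists>l\<in>B. {u, v} = {b, l})"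
    using broom by (auto simp: is_broom_def)
  have fin: "finite (verts G)"
    using G by (simp add: simple_graph_def)
  have adj_m: "adj G m w \<longleftrightarrow> w = a" and adj_a: "adj G a w \<longleftrightarrow> w = m \<or> w = b"
    and adj_b: "adj G b w \<longleftrightarrow> w = a \<or> w \<in> B" for w
    using dist by (auto simp: E doubleton_eq_iff)
  have adj_B: "adj G l w \<longleftrightarrow> w = b" if "l \<in> B" for l w
    using dist that by (auto simp: E doubleton_eq_iff)
  note adj = adj_m adj_a adj_b adj_B
  have g01: "\<forall>v\<in>verts G. g v \<in> {0..1}"
    using g by (simp add: resolving_function_def)
  \<comment> \<open>The values of a resolving function may not exceed 1, hence the truncation at \<open>a\<close>.\<close>
  define h where "h = g(a := min 1 (g a + g b), b := 0)"
  have h01: "\<forall>v\<in>verts G. h v \<in> {0..1}"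
    using g01 V by (auto simp: h_def)
  have R_V: "?R x y \<subseteq> verts G" for x y
    by (auto simp: resolving_set_def)
  have L_V: "?L x y \<subseteq> verts G" for x y
    by (auto simp: adj_resolving_set_def)

  have "g l1 + g l2 \<ge> 1"
    by (rule complement_twins_weight[OF G g, where c = b and t = m])
      (use l dist V in \<open>auto simp: adj\<close>)
  then have "sum h {l1, l2} \<ge> 1"
    using l dist by (auto simp: h_def)
  have B_enough: "sum h A \<ge> 1" if "B \<subseteq> A" "A \<subseteq> verts G" for A
  proof -
    have "{l1, l2} \<subseteq> A"
      using that(1) l by blast
    then show ?thesis
      using sum_mono_set[OF fin h01 _ that(2), of "{l1, l2}"] \<open>sum h {l1, l2} \<ge> 1\<close> by linarith
  qed
  have L_b: "B \<subseteq> ?L b y" if "y \<noteq> a" "y \<noteq> b" "y \<in> verts G" for y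
    using that V dist by (auto simp: adj_resolving_set_def adj)
  have sum_without: "sum h (A - {a, b}) = sum g (A - {a, b})" for A
    by (intro sum.cong) (auto simp: h_def)
  have shift: "sum h A \<ge> 1" if A: "A \<subseteq> verts G" "sum g A \<ge> 1" "b \<in> A \<Longrightarrow> a \<in> A" for A
  proof -
    have finA: "finite A"
      using A(1) fin finite_subset by blast
    have nonneg: "sum g (A - {a, b}) \<ge> 0"
      using g01 A(1) by (intro sum_nonneg) auto
    have split: "sum f A = sum f (A - {a, b}) + sum f (A \<inter> {a, b})" for f :: "'a \<Rightarrow> real"
      using sum.Int_Diff[OF finA, of f "{a, b}"] by simp
    have "g b \<ge> 0"
      using g01 V by auto
    have sum_h: "sum h A = sum g (A - {a, b}) + sum h (A \<inter> {a, b})"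
      using split[of h] by (simp only: sum_without)
    have h_ab: "h a = min 1 (g a + g b)" "h b = 0"
      using dist by (simp_all add: h_def)
    have "A \<inter> {a, b} = {} \<or> A \<inter> {a, b} = {a} \<or> A \<inter> {a, b} = {a, b}"
      using A(3) by blast
    then show ?thesis
    proof (elim disjE)
      assume "A \<inter> {a, b} = {}"
      then have "sum g (A \<inter> {a, b}) = 0" "sum h (A \<inter> {a, b}) = 0"
        by simp_all
      then show ?thesis
        using A(2) split[of g] sum_h by linarith
    next
      assume "A \<inter> {a, b} = {a}"
      then have "sum g (A \<inter> {a, b}) = g a" "sum h (A \<inter> {a, b}) = min 1 (g a + g b)"
        by (simp_all add: h_ab)
      then show ?thesis
        using A(2) split[of g] sum_h nonneg \<open>g b \<ge> 0\<close> by linarith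
    next
      assume "A \<inter> {a, b} = {a, b}"
      then have "sum g (A \<inter> {a, b}) = g a + g b" "sum h (A \<inter> {a, b}) = min 1 (g a + g b)"
        using dist by (simp_all add: h_ab)
      then show ?thesis
        using A(2) split[of g] sum_h nonneg by linarith
    qed
  qed

  have h_complement: "resolving_function (complement G) h"
    unfolding resolving_function_def verts_complement
  proof (intro conjI ballI impI)
    fix x y assume xy: "x \<in> verts G" "y \<in> verts G" "x \<noteq> y"
    have L_R: "?L x y \<subseteq> ?R x y"
      using adj_resolving_set_subset[of x "complement G" y] xy
      by (simp add: adj_resolving_set_complement)
    show "sum h (?R x y) \<ge> 1"
    proof (cases "b \<in> ?R x y \<longrightarrow> a \<in> ?R x y")
      case True
      then show ?thesis
        using resolving_functionD[OF g, of x y] xy R_V by (intro shift) auto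
    next
      case False
      then have a: "a \<notin> ?L x y" and b: "b \<in> ?R x y"
        using L_R by auto
      have xya: "x \<noteq> a" "y \<noteq> a"
        using a V by (auto simp: adj_resolving_set_def)
      show ?thesis
      proof (cases "x = b \<or> y = b")
        case True
        then have "B \<subseteq> ?L x y"
          using L_b xya xy adj_resolving_set_commute by metis
        then show ?thesis
          using B_enough L_R R_V by blast
      next
        case False
        have "adj G x a = adj G y a"
          using a V by (auto simp: adj_resolving_set_def)
        with False xya xy V have xyB: "x \<in> B" "y \<in> B"
          by (auto simp: adj dist)
        \<comment> \<open>Two leaves at \<open>b\<close>: neither of their edges to \<open>b\<close> dominates \<open>m\<close>, so \<open>b\<close> cannot resolve
          them.\<close>
        then have nb: "b \<notin> ?L x y"
          using dist by (auto simp: adj_resolving_set_def adj)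
        from complement_resolves_beyond_adj(3)[OF G xy(1,2) b nb] have False
          using V xyB dist by (auto simp: dominating_pair_def adj)
        then show ?thesis ..
      qed
    qed
  qed (use h01 in auto)

  have h_G: "resolving_function G h"
    unfolding resolving_function_def
  proof (intro conjI ballI impI)
    fix x y assume xy: "x \<in> verts G" "y \<in> verts G" "x \<noteq> y"
    have "sum h (?L x y) \<ge> 1"
    proof (cases "x \<noteq> a \<and> y \<noteq> a \<and> (x = b \<or> y = b)")
      case True
      then have "B \<subseteq> ?L x y"
        using L_b xy adj_resolving_set_commute by metis
      then show ?thesis
        using B_enough L_V by blast
    next
      case False
      \<comment> \<open>A vertex resolving \<open>x, y\<close> beyond \<open>L(x,y)\<close> is a common neighbour of them. Only \<open>a\<close> and \<open>b\<close>
        have two neighbours, and those of \<open>a\<close> are \<open>m\<close> and \<open>b\<close>, the pair treated in the other case.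
        So it is \<open>b\<close>, which no longer carries weight.\<close>
      have "?R x y \<subseteq> insert b (?L x y)"
      proof
        fix z assume z: "z \<in> ?R x y"
        show "z \<in> insert b (?L x y)"
        proof (rule ccontr)
          assume "z \<notin> insert b (?L x y)"
          then have nz: "z \<notin> ?L x y" "z \<noteq> b"
            by auto
          have "z \<in> verts G"
            using z R_V by blast
          moreover have "adj G z x" "adj G z y"
            using complement_resolves_beyond_adj(1,2)[OF G xy(1,2) z nz(1)]
            by (simp_all add: adj_commute)
          ultimately show False
            using nz(2) False xy(3) V dist by (auto simp: adj)
        qed
      qed
      then have "sum h (?R x y) \<le> sum h (insert b (?L x y))"
        using sum_mono_set[OF fin h01] L_V V by (metis Un_insert_left insertI1 insert_subset insert_commute)
      also have "\<dots> = sum h (?L x y)"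
        using finite_subset[OF L_V fin] by (simp add: sum.insert_if h_def)
      finally show ?thesis
        using resolving_functionD[OF h_complement, of x y] xy by simp
    qed
    also have "\<dots> \<le> sum h (resolving_set G x y)"
      using adj_resolving_set_subset[OF xy]
      by (intro sum_mono_set[OF fin h01]) (auto simp: resolving_set_def)
    finally show "sum h (resolving_set G x y) \<ge> 1" .
  qed (use h01 in auto)

  have "sum f (verts G) = sum f (verts G - {a, b}) + (f a + f b)" for f :: "'a \<Rightarrow> real"
    using sum.subset_diff[of "{a, b}" "verts G" f] fin V dist by auto
  then have "sum h (verts G) \<le> sum g (verts G)"
    using dist by (simp add: sum_without) (simp add: h_def)
  with h_G h_complement show thesis
    by (rule that)
qed

lemma broom_one_leaf_iso_P4:
  assumes "is_broom G m a b {l}"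
  shows "graph_iso G (path_graph 4)"
proof -
  have V: "verts G = {m, a, b, l}"
    and dist: "m \<noteq> a" "m \<noteq> b" "a \<noteq> b" "m \<noteq> l" "a \<noteq> l" "b \<noteq> l"
    and E: "\<And>u v. {u, v} \<in> edges G \<longleftrightarrow> {u, v} = {m, a} \<or> {u, v} = {a, b} \<or> {u, v} = {b, l}"
    using assms by (auto simp: is_broom_def adj_def)
  define f where "f = (\<lambda>_. 0 :: nat)(a := 1, b := 2, l := 3)"
  have f: "f m = 0" "f a = 1" "f b = 2" "f l = 3"
    using dist by (auto simp: f_def)
  have "verts (path_graph 4) = {0, 1, 2, 3}"
    by (auto simp: path_graph_def)
  then have "bij_betw f (verts G) (verts (path_graph 4))"
    using V dist f by (auto simp: bij_betw_def inj_on_def)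
  moreover have P: "{i, j} \<in> edges (path_graph 4) \<longleftrightarrow> (Suc i = j \<and> j < 4) \<or> (Suc j = i \<and> i < 4)" for i j
    by (auto simp: path_graph_def doubleton_eq_iff)
  have "\<forall>u\<in>verts G. \<forall>v\<in>verts G. {u, v} \<in> edges G \<longleftrightarrow> {f u, f v} \<in> edges (path_graph 4)"
    unfolding E P V using dist by (auto simp: f doubleton_eq_iff)
  ultimately show ?thesis
    unfolding graph_iso_def by blast
qed

section \<open>Graphs without short cycles\<close>

definition girth_ge_5 :: "'a ugraph \<Rightarrow> bool" where
  "girth_ge_5 G \<longleftrightarrow> (\<forall>xs. gcycle G xs \<longrightarrow> length xs \<ge> 5)"

lemma no_triangle:
  assumes "simple_graph G" "girth_ge_5 G" "adj G u v" "adj G v w"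
  shows "\<not> adj G w u"
proof
  assume "adj G w u"
  then have "gcycle G [u, v, w]"
    using assms adj_irrefl[OF assms(1)] adj_in_verts[OF assms(1)]
    by (auto simp: gcycle_def gpath_def adj_def)
  then show False
    using assms(2) by (auto simp: girth_ge_5_def)
qed

lemma no_four_cycle:
  assumes "simple_graph G" "girth_ge_5 G" "adj G u v" "adj G v w" "adj G w t" "u \<noteq> w" "v \<noteq> t"
  shows "\<not> adj G t u"
proof
  assume "adj G t u"
  then have "gcycle G [u, v, w, t]"
    using assms adj_irrefl[OF assms(1)] adj_in_verts[OF assms(1)]
    by (auto simp: gcycle_def gpath_def adj_def)
  then show False
    using assms(2) by (auto simp: girth_ge_5_def)
qed

text \<open>A further neighbour of \<open>u\<close> would be adjacent to \<open>a\<close> or to \<open>b\<close> by domination, closing a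
  triangle or a four-cycle.\<close>

lemma dominating_edge_other_neighbours:
  assumes G: "simple_graph G" "girth_ge_5 G" and ab: "adj G a b" "dominating_pair G a b"
    and u: "adj G a u" "u \<noteq> b"
  shows "adj G u w \<longleftrightarrow> w = a"
proof
  assume uw: "adj G u w"
  show "w = a"
  proof (rule ccontr)
    assume "w \<noteq> a"
    have "w \<noteq> b"
      using no_triangle[OF G, of a u b] u uw ab(1) by (auto simp: adj_commute)
    then have "adj G a w \<or> adj G b w"
      using ab(2) adj_in_verts[OF G(1) uw] \<open>w \<noteq> a\<close> by (auto simp: dominating_pair_def)
    then show False
      using no_triangle[OF G, of a u w] no_four_cycle[OF G, of a u w b] u uw ab \<open>w \<noteq> a\<close>
      by (auto simp: adj_commute)
  qed
qed (use u in \<open>simp add: adj_commute\<close>)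

lemma dominating_edge_broom:
  assumes G: "simple_graph G" "girth_ge_5 G" and ab: "adj G a b" "dominating_pair G a b"
    and m: "\<And>w. adj G a w \<longleftrightarrow> w = b \<or> w = m" "m \<noteq> b"
  shows "is_broom G m a b {l. adj G b l \<and> l \<noteq> a}"
proof -
  let ?B = "{l. adj G b l \<and> l \<noteq> a}"
  have ba: "adj G b a" "dominating_pair G b a"
    using ab by (auto simp: adj_commute dominating_pair_def)
  have am: "adj G a m"
    using m by simp
  note nb_m = dominating_edge_other_neighbours[OF G ab am m(2)]
  have nb_B: "adj G l w \<longleftrightarrow> w = b" if "adj G b l" "l \<noteq> a" for l w
    using dominating_edge_other_neighbours[OF G ba that] .
  have dist: "m \<noteq> a" "m \<noteq> b" "a \<noteq> b"
    using adj_irrefl[OF G(1)] am ab(1) m(2) by auto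
  have nbm: "\<not> adj G b m"
    using nb_m[of b] dist by (simp add: adj_commute)
  have V: "verts G = {m, a, b} \<union> ?B"
  proof
    show "verts G \<subseteq> {m, a, b} \<union> ?B"
      using ab(2) m(1) by (auto simp: dominating_pair_def)
    show "{m, a, b} \<union> ?B \<subseteq> verts G"
      using adj_in_verts[OF G(1)] am ab(1) by blast
  qed
  have "adj G u v \<longleftrightarrow> {u, v} = {m, a} \<or> {u, v} = {a, b} \<or> (\<exists>l\<in>?B. {u, v} = {b, l})" for u v
  proof
    assume uv: "adj G u v"
    then have "u \<in> {m, a, b} \<union> ?B"
      using adj_in_verts[OF G(1)] V by blast
    then show "{u, v} = {m, a} \<or> {u, v} = {a, b} \<or> (\<exists>l\<in>?B. {u, v} = {b, l})"
      using uv nb_m nb_B m(1) by (auto simp: doubleton_eq_iff)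
  next
    assume "{u, v} = {m, a} \<or> {u, v} = {a, b} \<or> (\<exists>l\<in>?B. {u, v} = {b, l})"
    then show "adj G u v"
      using am ab(1) by (auto simp: doubleton_eq_iff adj_commute)
  qed
  moreover have "?B \<inter> {m, a, b} = {}" "distinct [m, a, b]"
    using dist nbm adj_irrefl[OF G(1), of b] by auto
  ultimately show ?thesis
    unfolding is_broom_def using V by blast
qed

text \<open>Some \<open>L(x,y)\<close> has weight less than 1, so a vertex \<open>b\<close> outside it resolves \<open>x, y\<close> in the
  complement. This produces a dominating edge \<open>ab\<close> with \<open>a\<close> one of \<open>x, y\<close>, the other one being a
  leaf \<open>l\<close> at \<open>b\<close>. Two leaves at \<open>a\<close> would be twins of weight at least 1 inside \<open>L(a,l)\<close>.\<close>

lemma broom_if_not_resolving: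
  assumes G: "simple_graph G" "girth_ge_5 G"
    and g: "resolving_function (complement G) g" "\<not> resolving_function G g"
  obtains m a b B where "is_broom G m a b B" "B \<noteq> {}"
proof -
  let ?R = "resolving_set (complement G)" and ?L = "adj_resolving_set G"
  have fin: "finite (verts G)"
    using G by (simp add: simple_graph_def)
  have g01: "\<forall>v\<in>verts G. g v \<in> {0..1}"
    using g by (simp add: resolving_function_def)
  have L_V: "?L x y \<subseteq> verts G" for x y
    by (auto simp: adj_resolving_set_def)
  obtain x y where xy: "x \<in> verts G" "y \<in> verts G" "x \<noteq> y" and "sum g (resolving_set G x y) < 1"
    using g(2) g01 by (auto simp: resolving_function_def not_le)
  moreover have "sum g (?L x y) \<le> sum g (resolving_set G x y)"
    using adj_resolving_set_subset[OF xy]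
    by (intro sum_mono_set[OF fin g01]) (auto simp: resolving_set_def)
  ultimately have L_lt: "sum g (?L x y) < 1"
    by simp
  have "\<not> ?R x y \<subseteq> ?L x y"
    using sum_mono_set[OF fin g01 _ L_V, of "?R x y"] L_lt resolving_functionD[OF g(1), of x y] xy
    by fastforce
  then obtain b where b: "b \<in> ?R x y" "b \<notin> ?L x y"
    by blast
  note * = complement_resolves_beyond_adj[OF G(1) xy(1,2) b]
  obtain w where w: "w \<in> verts G" "w \<noteq> b" "\<not> adj G b w"
    using *(4) by blast
  obtain a l where al: "a \<in> verts G" "l \<in> verts G" "a \<noteq> l" "sum g (?L a l) < 1"
    and ab: "adj G a b" "dominating_pair G a b" and bl: "adj G b l"
  proof (cases "dominating_pair G x b")
    case True
    then show thesis
      using that[of x y] xy L_lt *(1,2) by (simp add: adj_commute)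
  next
    case False
    then show thesis
      using that[of y x] xy L_lt *(1-3) by (simp add: adj_commute adj_resolving_set_commute)
  qed
  have ba: "adj G b a" "dominating_pair G b a"
    using ab by (auto simp: adj_commute dominating_pair_def)
  have nb_l: "adj G l v \<longleftrightarrow> v = b" for v
    using dominating_edge_other_neighbours[OF G ba bl] al(3) by auto
  have "w \<noteq> a"
    using w(3) ba(1) by auto
  then have aw: "adj G a w"
    using ab(2) w by (auto simp: dominating_pair_def)
  have "adj G a v \<longleftrightarrow> v = b \<or> v = w" for v
  proof
    assume av: "adj G a v"
    show "v = b \<or> v = w"
    proof (rule ccontr)
      assume neq: "\<not> (v = b \<or> v = w)"
      have nb: "adj G u t \<longleftrightarrow> t = a" if "u \<in> {v, w}" for u t
        using dominating_edge_other_neighbours[OF G ab, of u t] av aw w(2) neq that by auto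
      have la: "\<not> adj G a l"
        using nb_l[of a] adj_irrefl[OF G(1), of b] ba(1) by (auto simp: adj_commute)
      have "1 \<le> g v + g w"
      proof (rule complement_twins_weight[OF G(1) g(1), where c = a and t = l])
        show "l \<notin> {v, w, a}"
          using la av aw al(3) by auto
      qed (use nb al la neq in auto)
      also have "\<dots> = sum g {v, w}"
        using neq by simp
      also have "\<dots> \<le> sum g (?L a l)"
      proof (rule sum_mono_set[OF fin g01 _ L_V])
        show "{v, w} \<subseteq> ?L a l"
          using adj_in_verts[OF G(1)] av aw nb_l neq w(2) by (auto simp: adj_resolving_set_def)
      qed
      finally show False
        using al(4) by simp
    qed
  qed (use ab aw in auto)
  then have "is_broom G w a b {l. adj G b l \<and> l \<noteq> a}"
    using w by (intro dominating_edge_broom[OF G ab]) auto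
  then show thesis
    by (rule that) (use bl al(3) in auto)
qed

text \<open>It suffices to turn an optimal resolving function of the complement into one that also
  resolves \<open>G\<close>, without increasing its weight.\<close>

theorem sim_frac_dim_complement:
  assumes G: "simple_graph G" "girth_ge_5 G" and P4: "\<not> graph_iso G (path_graph 4)"
  shows "sim_frac_dim G (complement G) = frac_dim (complement G)"
    and "frac_dim G \<le> frac_dim (complement G)"
proof -
  note H = simple_graph_complement[OF G(1)]
  note sim = sim_frac_dim_attained[OF G(1) H verts_complement[symmetric]]
  obtain g where g: "resolving_function (complement G) g"
      "sum g (verts G) = frac_dim (complement G)"
    using frac_dim_attained(1)[OF H] by auto
  obtain h where h: "resolving_function G h" "resolving_function (complement G) h"
      "sum h (verts G) \<le> sum g (verts G)"
  proof (cases "resolving_function G g")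
    case True
    then show thesis
      using that g by blast
  next
    case False
    then obtain m a b B where B: "is_broom G m a b B" "B \<noteq> {}"
      using broom_if_not_resolving[OF G g(1)] by blast
    then obtain l where l: "l \<in> B"
      by blast
    then have "B \<noteq> {l}"
      using broom_one_leaf_iso_P4 P4 B(1) by metis
    then obtain l' where "l' \<in> B" "l' \<noteq> l"
      using l by blast
    then show thesis
      using broom_exchange[OF G(1) B(1) _ l _ g(1)] that by blast
  qed
  obtain f where f: "resolving_function G f" "resolving_function (complement G) f"
      "sum f (verts G) = sim_frac_dim G (complement G)"
    using sim(1) by blast
  have "sim_frac_dim G (complement G) \<le> frac_dim (complement G)"
    using sim(2)[OF h(1,2)] h(3) g(2) by simp
  moreover have "frac_dim (complement G) \<le> sim_frac_dim G (complement G)"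
    using frac_dim_attained(2)[OF H f(2)] f(3) by simp
  ultimately show eq: "sim_frac_dim G (complement G) = frac_dim (complement G)"
    by simp
  show "frac_dim G \<le> frac_dim (complement G)"
    using frac_dim_attained(2)[OF G(1) f(1)] f(3) eq by simp
qed

theorem theorem3p11:
  fixes T :: "'a ugraph"
  assumes "tree T"
    and "card (verts T) \<ge> 2"
    and "\<not> graph_iso T (path_graph 4)"
  shows "sim_frac_dim T (complement T) = frac_dim (complement T) \<and>
         frac_dim (complement T) \<ge> frac_dim T"
proof -
  have "simple_graph T" "girth_ge_5 T"
    using assms(1) by (auto simp: tree_def girth_ge_5_def)
  then show ?thesis
    using sim_frac_dim_complement assms(3) by blast
qed

end
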